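(* Let $n>k\geqslant 1$ be integers and let $\sigma\in S_n$. Then $\sigma$ is $k$-prolific if and only if $\mathrm{br}(\sigma)\geqslant k+2$.
   Context: $S_n$ is the set of permutations of $[n]=\{1,\dots,n\}$, written in one-line notation $\sigma=\sigma(1)\cdots\sigma(n)$. A permutation $\sigma\in S_n$ contains $\pi\in S_r$ (written $\pi\preceq\sigma$) if there are indices $i_1<\dots<i_r$ with $\sigma(i_1)\cdots\sigma(i_r)$ in the same relative order as $\pi$. For $n>k\geqslant1$, $\sigma\in S_n$ is $k$-prolific if $|\{\pi\in S_{n-k}:\pi\preceq\sigma\}|=\binom{n}{k}$. The distance between entries $i,j$ of $\sigma$ is $d_\sigma(i,j)=|i-j|+|\sigma(i)-\sigma(j)|$ (the $L_1$ distance between the points $(i,\sigma(i))$ and $(j,\sigma(j))$), and for $n>1$ the breadth of $\sigma$ is $\mathrm{br}(\sigma)=\min_{i\neq j} d_\sigma(i,j)$. *)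

theory Defs
  imports "HOL-Combinatorics.Permutations"
begin

text \<open>
  A member of \<open>Sym n\<close> is a function on all of \<open>nat\<close> that fixes every point outside \<open>{1..n}\<close>,
  so that distinct permutations of \<open>{1..n}\<close> are distinct functions and counting is meaningful.
\<close>

definition Sym :: "nat \<Rightarrow> (nat \<Rightarrow> nat) set" where
  "Sym n = {\<sigma>. \<sigma> permutes {1..n}}"

definition contained_in :: "nat \<Rightarrow> (nat \<Rightarrow> nat) \<Rightarrow> nat \<Rightarrow> (nat \<Rightarrow> nat) \<Rightarrow> bool" where
  "contained_in r \<pi> n \<sigma> \<longleftrightarrow>
     (\<exists>f. f ` {1..r} \<subseteq> {1..n} \<and> strict_mono_on {1..r} f \<and>
          (\<forall>a\<in>{1..r}. \<forall>b\<in>{1..r}. \<sigma> (f a) < \<sigma> (f b) \<longleftrightarrow> \<pi> a < \<pi> b))"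

definition prolific :: "nat \<Rightarrow> nat \<Rightarrow> (nat \<Rightarrow> nat) \<Rightarrow> bool" where
  "prolific k n \<sigma> \<longleftrightarrow>
     card {\<pi> \<in> Sym (n - k). contained_in (n - k) \<pi> n \<sigma>} = n choose k"

definition entry_dist :: "(nat \<Rightarrow> nat) \<Rightarrow> nat \<Rightarrow> nat \<Rightarrow> int" where
  "entry_dist \<sigma> i j = \<bar>int i - int j\<bar> + \<bar>int (\<sigma> i) - int (\<sigma> j)\<bar>"

text \<open>The minimum is over a nonempty set only for \<open>n > 1\<close>.\<close>

definition breadth :: "nat \<Rightarrow> (nat \<Rightarrow> nat) \<Rightarrow> int" where
  "breadth n \<sigma> = Min {entry_dist \<sigma> i j | i j. i \<in> {1..n} \<and> j \<in> {1..n} \<and> i \<noteq> j}"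

end

theory Submission
  imports Defs "HOL-Library.Infinite_Set"
begin

text \<open>
  The patterns of length \<open>n - k\<close> contained in \<open>\<sigma>\<close> are the patterns of the \<open>(n - k)\<close>-subsets of
  the entries, so \<open>\<sigma>\<close> is \<open>k\<close>-prolific iff distinct subsets have distinct patterns.

  If two entries \<open>i\<close>, \<open>j\<close> are at distance at most \<open>k + 1\<close>, at most \<open>k - 1\<close> entries lie strictly
  between them in position or in value. Once \<open>k - 1\<close> entries including all of these are deleted,
  deleting \<open>i\<close> or deleting \<open>j\<close> leaves the same pattern.

  Conversely, let \<open>A \<noteq> B\<close> have the same pattern and let \<open>\<phi> : A \<rightarrow> B\<close> be the order isomorphism. Up to
  reflection some point moves right and up, and tracing it back along \<open>\<phi>\<close> gives such a point in
  \<open>A - B\<close>. The horizontal displacement of \<open>x\<close> and the vertical displacement of \<open>x'\<close> are each bounded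
  by a number of deleted points, hence their sum by \<open>k\<close> plus the number of points counted twice.
  If all distances are at least \<open>k + 2\<close>, then taking \<open>x = x'\<close> shows that below and to the left of the
  image of a minimal point of \<open>A - B\<close> moving right and up there is another such minimal point. Along
  this antichain one finds \<open>x\<close>, \<open>x'\<close> that both lie below and to the left of both \<open>\<phi> x\<close> and
  \<open>\<phi> x'\<close>; the bound for this pair shows that \<open>x\<close> and \<open>x'\<close> are at distance at most \<open>k\<close>.
\<close>

lemma ex_minimizer:
  fixes f :: "'a \<Rightarrow> 'b::linorder"
  assumes "finite S" "S \<noteq> {}"
  obtains m where "m \<in> S" "\<And>w. w \<in> S \<Longrightarrow> f m \<le> f w"
  using arg_min_if_finite(1)[OF assms] arg_min_least[OF assms] by blast

section \<open>Order isomorphisms between subsets of an interval\<close>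

locale interval_shift =
  fixes V A B :: "'a set" and \<phi> :: "'a \<Rightarrow> 'a" and n :: int and p :: "'a \<Rightarrow> int"
  assumes A_subset: "A \<subseteq> V" and B_subset: "B \<subseteq> V" and bij_phi: "bij_betw \<phi> A B"
    and bij_coord: "bij_betw p V {1..n}"
    and less_iff: "\<lbrakk>u \<in> A; v \<in> A\<rbrakk> \<Longrightarrow> p (\<phi> u) < p (\<phi> v) \<longleftrightarrow> p u < p v"
begin

lemma finite_V: "finite V"
  using bij_betw_finite[OF bij_coord] by simp

lemma phi_in_B: "u \<in> A \<Longrightarrow> \<phi> u \<in> B"
  using bij_phi by (auto simp: bij_betw_def)

lemma coord_eq_iff: "\<lbrakk>u \<in> V; v \<in> V\<rbrakk> \<Longrightarrow> p u = p v \<longleftrightarrow> u = v"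
  using bij_coord by (auto simp: bij_betw_def inj_on_def)

lemma card_coord_between:
  assumes "a < b"
  shows "int (card {z \<in> V. a < p z \<and> p z < b}) \<le> b - a - 1"
proof -
  have "card {z \<in> V. a < p z \<and> p z < b} \<le> card {a<..<b}"
    using bij_coord by (intro card_inj_on_le[where f = p]) (auto simp: bij_betw_def inj_on_def)
  then show ?thesis using assms by simp
qed

lemma coord_eq_card:
  assumes "C \<subseteq> V" "y \<in> V"
  shows "p y - 1 = int (card {z \<in> C. p z < p y}) + int (card {z \<in> V - C. p z < p y})"
proof -
  have range: "1 \<le> p y" "p y \<le> n" using bij_coord \<open>y \<in> V\<close> by (auto simp: bij_betw_def)
  have "bij_betw p {z \<in> V. p z < p y} {1..<p y}"
    using bij_coord range by (intro bij_betw_subset[OF bij_coord]) (force simp: bij_betw_def)+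
  then have "int (card {z \<in> V. p z < p y}) = p y - 1"
    using range by (simp add: bij_betw_same_card)
  moreover have "{z \<in> V. p z < p y} = {z \<in> C. p z < p y} \<union> {z \<in> V - C. p z < p y}"
    using \<open>C \<subseteq> V\<close> by auto
  moreover have "finite {z \<in> C. p z < p y}" "finite {z \<in> V - C. p z < p y}"
    using finite_V finite_subset[OF \<open>C \<subseteq> V\<close>] by auto
  ultimately show ?thesis by (simp add: card_Un_disjoint disjoint_iff)
qed

lemma displacement_eq_card:
  assumes "x \<in> A"
  shows "p (\<phi> x) - p x =
    int (card {z \<in> V - B. p z < p (\<phi> x)}) - int (card {z \<in> V - A. p z < p x})"
proof -
  have "bij_betw \<phi> {u \<in> A. p u < p x} {z \<in> B. p z < p (\<phi> x)}"
    using bij_phi less_iff[OF _ assms]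
    by (intro bij_betw_subset[OF bij_phi]) (auto simp: bij_betw_def)
  then have "card {u \<in> A. p u < p x} = card {z \<in> B. p z < p (\<phi> x)}"
    by (rule bij_betw_same_card)
  moreover have "x \<in> V" "\<phi> x \<in> V" using assms A_subset B_subset phi_in_B by auto
  ultimately show ?thesis
    using coord_eq_card[OF A_subset, of x] coord_eq_card[OF B_subset, of "\<phi> x"] by linarith
qed

text \<open>Iterating \<open>\<phi>\<close> from a left-moving point of \<open>A - B\<close> ends at a point of \<open>B - A\<close> further left.\<close>

lemma card_left_movers_le:
  assumes x: "x \<in> A" "p x < p (\<phi> x)"
  shows "card {u \<in> A - B. p (\<phi> u) < p u \<and> p u < p x} \<le> card {z \<in> B - A. p z < p x}"
proof -
  define L where "L = {u \<in> A. p (\<phi> u) < p u \<and> p u < p x}"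
  have finite_L: "finite L" using finite_V finite_subset[OF A_subset] unfolding L_def by auto
  have "L \<inter> B \<subseteq> \<phi> ` L"
  proof
    fix u assume u: "u \<in> L \<inter> B"
    then obtain w where w: "w \<in> A" "u = \<phi> w" using bij_phi by (auto simp: bij_betw_def)
    then have "p (\<phi> w) < p w" "p w < p x"
      using u x less_iff[of u w] less_iff[of w x] unfolding L_def by auto
    then show "u \<in> \<phi> ` L" using w unfolding L_def by auto
  qed
  then have "L - B = L - \<phi> ` L" using phi_in_B unfolding L_def by auto
  moreover have "\<phi> ` L - L \<subseteq> {z \<in> B - A. p z < p x}"
    using phi_in_B less_iff unfolding L_def by fastforce
  moreover have "card (L - \<phi> ` L) \<le> card (\<phi> ` L - L)"
  proof (rule card_le_sym_Diff)
    have "inj_on \<phi> L" using bij_phi unfolding L_def by (auto simp: bij_betw_def inj_on_def)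
    then show "card L \<le> card (\<phi> ` L)" by (simp add: card_image)
  qed (use finite_L in auto)
  moreover have "finite {z \<in> B - A. p z < p x}" using finite_V finite_subset[OF B_subset] by auto
  moreover have "{u \<in> A - B. p (\<phi> u) < p u \<and> p u < p x} = L - B" unfolding L_def by auto
  ultimately show ?thesis by (metis card_mono order_trans)
qed

definition blockers :: "'a \<Rightarrow> 'a set" where
  "blockers x = {z \<in> V - B. p z < p (\<phi> x) \<and> (if z \<in> A then p z < p (\<phi> z) else p x < p z)}"

lemma finite_blockers: "finite (blockers x)"
  using finite_V unfolding blockers_def by simp

lemma deleted_below_image_subset:
  assumes "x \<in> A"
  shows "{z \<in> V - B. p z < p (\<phi> x)} \<subseteq> blockers x
    \<union> {u \<in> A - B. p (\<phi> u) < p u \<and> p u < p x} \<union> {z \<in> V - A - B. p z < p x}"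
proof
  fix z assume z: "z \<in> {z \<in> V - B. p z < p (\<phi> x)}"
  show "z \<in> blockers x \<union> {u \<in> A - B. p (\<phi> u) < p u \<and> p u < p x} \<union> {z \<in> V - A - B. p z < p x}"
  proof (cases "z \<in> A")
    case True
    then have "p (\<phi> z) \<noteq> p z" using z phi_in_B[OF True] B_subset coord_eq_iff[of "\<phi> z" z] by auto
    then show ?thesis using z True less_iff[OF True assms] unfolding blockers_def by auto
  next
    case False
    then have "p z \<noteq> p x" using z assms A_subset coord_eq_iff by blast
    then show ?thesis using z False unfolding blockers_def by auto
  qed
qed

lemma displacement_le_card_blockers:
  assumes x: "x \<in> A" "p x < p (\<phi> x)"
  shows "p (\<phi> x) - p x \<le> int (card (blockers x))"
proof -
  define left where "left = {u \<in> A - B. p (\<phi> u) < p u \<and> p u < p x}"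
  define void where "void = {z \<in> V - A - B. p z < p x}"
  define new where "new = {z \<in> B - A. p z < p x}"
  have finite: "finite left" "finite void" "finite new"
    using finite_V finite_subset[OF A_subset] finite_subset[OF B_subset]
    unfolding left_def void_def new_def by auto
  have "{z \<in> V - B. p z < p (\<phi> x)} \<subseteq> blockers x \<union> left \<union> void"
    unfolding left_def void_def by (rule deleted_below_image_subset[OF x(1)])
  then have "card {z \<in> V - B. p z < p (\<phi> x)} \<le> card (blockers x \<union> left \<union> void)"
    using finite finite_blockers by (intro card_mono) auto
  also have "\<dots> \<le> card (blockers x) + card left + card void"
    using card_Un_le[of "blockers x" left] card_Un_le[of "blockers x \<union> left" void] by linarith
  also have "card left \<le> card new"
    unfolding left_def new_def by (rule card_left_movers_le[OF x])
  also have "card (blockers x) + card new + card void = card (blockers x) + card (new \<union> void)"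
    using finite by (subst card_Un_disjoint) (auto simp: new_def void_def)
  also have "new \<union> void = {z \<in> V - A. p z < p x}"
    using B_subset unfolding new_def void_def by auto
  finally show ?thesis using displacement_eq_card[OF x(1)] by linarith
qed

lemma displacement_le_card_compl:
  assumes "x \<in> A" "p x < p (\<phi> x)"
  shows "p (\<phi> x) - p x \<le> int (card (V - B))"
proof -
  have "card (blockers x) \<le> card (V - B)"
    using finite_V by (intro card_mono) (auto simp: blockers_def)
  then show ?thesis using displacement_le_card_blockers[OF assms] by linarith
qed

lemma reflect: "interval_shift V A B \<phi> n (\<lambda>z. n + 1 - p z)"
proof
  have "bij_betw (\<lambda>t. n + 1 - t) {1..n} {1..n}"
    by (rule bij_betw_byWitness[where f' = "\<lambda>t. n + 1 - t"]) auto
  then show "bij_betw (\<lambda>z. n + 1 - p z) V {1..n}"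
    using bij_betw_trans[OF bij_coord] by (fastforce simp: comp_def)
qed (use A_subset B_subset bij_phi less_iff in auto)

end

section \<open>Order isomorphisms between subsets of a spread point set\<close>

locale spread_shift = X: interval_shift V A B \<phi> n p + Y: interval_shift V A B \<phi> n q
  for V A B :: "'a set" and \<phi> :: "'a \<Rightarrow> 'a" and n :: int and p q :: "'a \<Rightarrow> int" +
  assumes dist_ge: "\<lbrakk>u \<in> V; v \<in> V; u \<noteq> v\<rbrakk> \<Longrightarrow>
    int (card (V - B)) + 2 \<le> \<bar>p u - p v\<bar> + \<bar>q u - q v\<bar>"
begin

abbreviation num_deleted :: int where
  "num_deleted \<equiv> int (card (V - B))"

lemma swap_coordinates: "spread_shift V A B \<phi> n q p"
  by unfold_locales (use dist_ge in \<open>simp add: add.commute\<close>)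

lemma reflect_first: "spread_shift V A B \<phi> n (\<lambda>z. n + 1 - p z) q"
proof -
  interpret reflected: interval_shift V A B \<phi> n "\<lambda>z. n + 1 - p z" by (rule X.reflect)
  show ?thesis by unfold_locales (use dist_ge in \<open>simp add: abs_minus_commute\<close>)
qed

lemma reflect_second: "spread_shift V A B \<phi> n p (\<lambda>z. n + 1 - q z)"
  by (rule spread_shift.swap_coordinates[OF spread_shift.reflect_first[OF swap_coordinates]])

text \<open>A point of the box would be at distance at least \<open>num_deleted + 2\<close> from both corners.\<close>

lemma box_of_close_points_empty:
  assumes "u \<in> V" "v \<in> V" and close: "\<bar>p u - p v\<bar> + \<bar>q u - q v\<bar> \<le> 2 * num_deleted"
    and z: "z \<in> V" "z \<noteq> u" "z \<noteq> v"
      "p z \<in> {min (p u) (p v)..max (p u) (p v)}" "q z \<in> {min (q u) (q v)..max (q u) (q v)}"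
  shows False
proof -
  have "\<bar>p z - p u\<bar> + \<bar>p z - p v\<bar> = \<bar>p u - p v\<bar>" "\<bar>q z - q u\<bar> + \<bar>q z - q v\<bar> = \<bar>q u - q v\<bar>"
    using z(4,5) by (auto simp: min_def max_def split: if_splits)
  then show False using dist_ge[OF z(1) \<open>u \<in> V\<close> z(2)] dist_ge[OF z(1) \<open>v \<in> V\<close> z(3)] close
    by linarith
qed

lemma displacement_sum_le:
  assumes "x \<in> A" "p x < p (\<phi> x)" "x' \<in> A" "q x' < q (\<phi> x')"
  shows "p (\<phi> x) - p x + (q (\<phi> x') - q x') \<le>
    num_deleted + int (card (X.blockers x \<inter> Y.blockers x'))"
proof -
  have "card (X.blockers x \<union> Y.blockers x') \<le> card (V - B)"
    using X.finite_V by (intro card_mono) (auto simp: X.blockers_def Y.blockers_def)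
  moreover have "card (X.blockers x) + card (Y.blockers x') =
      card (X.blockers x \<union> Y.blockers x') + card (X.blockers x \<inter> Y.blockers x')"
    by (rule card_Un_Int[OF X.finite_blockers Y.finite_blockers])
  ultimately show ?thesis
    using X.displacement_le_card_blockers[OF assms(1,2)]
      Y.displacement_le_card_blockers[OF assms(3,4)] by linarith
qed

definition starts :: "'a set" where
  "starts = {e \<in> A - B. p e < p (\<phi> e) \<and> q e < q (\<phi> e)}"

definition min_starts :: "'a set" where
  "min_starts = {m \<in> starts. \<forall>e\<in>starts. p e \<le> p m \<longrightarrow> q e \<le> q m \<longrightarrow> e = m}"

lemma min_starts_subset: "min_starts \<subseteq> starts"
  unfolding min_starts_def by auto

lemma startsD:
  assumes "e \<in> starts"
  shows "e \<in> A" "e \<in> V" "\<phi> e \<in> V" "p e < p (\<phi> e)" "q e < q (\<phi> e)"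
  using assms X.A_subset X.B_subset X.phi_in_B unfolding starts_def by auto

lemma finite_starts: "finite starts"
  using startsD(2) by (intro finite_subset[OF _ X.finite_V] subsetI)

lemma common_blocker_in_A_imp_start:
  "\<lbrakk>z \<in> X.blockers x; z \<in> Y.blockers x'; z \<in> A\<rbrakk> \<Longrightarrow> z \<in> starts"
  unfolding X.blockers_def Y.blockers_def starts_def by auto

lemma ex_min_start_below:
  assumes "e \<in> starts"
  shows "\<exists>m\<in>min_starts. p m \<le> p e \<and> q m \<le> q e"
proof -
  define S where "S = {m \<in> starts. p m \<le> p e \<and> q m \<le> q e}"
  have "finite S" "S \<noteq> {}" using finite_starts assms unfolding S_def by auto
  then obtain m where m: "m \<in> S" "\<And>w. w \<in> S \<Longrightarrow> p m + q m \<le> p w + q w"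
    using ex_minimizer[of S "\<lambda>w. p w + q w"] by blast
  have "w = m" if w: "w \<in> starts" "p w \<le> p m" "q w \<le> q m" for w
  proof -
    have "w \<in> S" using w m(1) unfolding S_def by auto
    then have "p w = p m" using m(2) w(2,3) by fastforce
    then show ?thesis
      using X.coord_eq_iff[of w m] startsD(2) w(1) m(1) unfolding S_def by auto
  qed
  then show ?thesis using m(1) unfolding S_def min_starts_def by auto
qed

lemma min_starts_antichain:
  assumes "m \<in> min_starts" "m' \<in> min_starts" "m \<noteq> m'"
  shows "(p m < p m' \<and> q m' < q m) \<or> (p m' < p m \<and> q m < q m')"
proof -
  have "\<not> (p m \<le> p m' \<and> q m \<le> q m')" "\<not> (p m' \<le> p m \<and> q m' \<le> q m)"
    using assms unfolding min_starts_def by blast+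
  then show ?thesis by linarith
qed

lemma start_box_empty:
  assumes start: "x \<in> starts" and z: "z \<in> V" "z \<noteq> x"
  shows "\<not> (p x \<le> p z \<and> p z < p (\<phi> x) \<and> q x \<le> q z \<and> q z < q (\<phi> x))"
proof
  note x = startsD[OF start]
  assume box: "p x \<le> p z \<and> p z < p (\<phi> x) \<and> q x \<le> q z \<and> q z < q (\<phi> x)"
  show False
  proof (rule box_of_close_points_empty[OF x(2,3) _ z])
    show "\<bar>p x - p (\<phi> x)\<bar> + \<bar>q x - q (\<phi> x)\<bar> \<le> 2 * num_deleted"
      using X.displacement_le_card_compl[OF x(1,4)] Y.displacement_le_card_compl[OF x(1,5)] x
      by linarith
  qed (use box in auto)
qed

lemma ex_other_min_start:
  assumes x: "x \<in> min_starts"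
  shows "\<exists>m\<in>min_starts. m \<noteq> x \<and> p m < p (\<phi> x) \<and> q m < q (\<phi> x)"
proof -
  have start: "x \<in> starts" using x min_starts_subset by auto
  note mv = startsD[OF start]
  have "x \<noteq> \<phi> x" using mv(4) by auto
  then have "num_deleted + 2 \<le> p (\<phi> x) - p x + (q (\<phi> x) - q x)"
    using dist_ge[OF mv(2,3)] mv(4,5) by linarith
  also have "\<dots> \<le> num_deleted + int (card (X.blockers x \<inter> Y.blockers x))"
    by (rule displacement_sum_le[OF mv(1,4) mv(1,5)])
  finally have "\<not> X.blockers x \<inter> Y.blockers x \<subseteq> {x}"
    using card_mono[of "{x}" "X.blockers x \<inter> Y.blockers x"] by auto
  then obtain z where z: "z \<in> X.blockers x" "z \<in> Y.blockers x" "z \<noteq> x" by blast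
  then have below: "z \<in> V" "p z < p (\<phi> x)" "q z < q (\<phi> x)"
    unfolding X.blockers_def Y.blockers_def by auto
  have outside: "\<not> (p x \<le> p z \<and> q x \<le> q z)"
    using start_box_empty[OF start below(1) z(3)] below by blast
  then have "z \<in> A" using z unfolding X.blockers_def Y.blockers_def by (auto split: if_splits)
  then obtain m where m: "m \<in> min_starts" "p m \<le> p z" "q m \<le> q z"
    using ex_min_start_below common_blocker_in_A_imp_start z by blast
  then have "m \<noteq> x" using outside by blast
  then show ?thesis using m below by (intro bexI[of _ m]) auto
qed

definition right_neighbour :: "'a \<Rightarrow> 'a \<Rightarrow> bool" where
  "right_neighbour x m \<longleftrightarrow> x \<in> min_starts \<and> m \<in> min_starts \<and>
     p x < p m \<and> p m < p (\<phi> x) \<and> q m < q x"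

definition crossing :: "'a \<Rightarrow> 'a \<Rightarrow> bool" where
  "crossing x x' \<longleftrightarrow> right_neighbour x x' \<and> q x < q (\<phi> x')"

lemma ex_right_neighbour:
  assumes "starts \<noteq> {}"
  shows "\<exists>x m. right_neighbour x m"
proof -
  have "finite min_starts" by (rule finite_subset[OF min_starts_subset finite_starts])
  moreover have "min_starts \<noteq> {}" using ex_min_start_below assms by blast
  ultimately obtain x where x: "x \<in> min_starts" "\<And>m. m \<in> min_starts \<Longrightarrow> p x \<le> p m"
    using ex_minimizer[of min_starts p] by blast
  obtain m where m: "m \<in> min_starts" "m \<noteq> x" "p m < p (\<phi> x)"
    using ex_other_min_start[OF x(1)] by blast
  then have "right_neighbour x m"
    using min_starts_antichain[OF x(1) m(1)] x unfolding right_neighbour_def by force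
  then show ?thesis by blast
qed

text \<open>A minimal start below and to the left of \<open>\<phi> x'\<close> lies left of \<open>x'\<close>, hence left of \<open>x\<close> since
  otherwise \<open>x'\<close> would be its right neighbour; so it is at least as high as \<open>x\<close>.\<close>

lemma rightmost_right_neighbour_crossing:
  assumes x': "right_neighbour x x'" and rightmost: "\<And>w m. right_neighbour w m \<Longrightarrow> p w \<le> p x"
  shows "crossing x x'"
proof -
  have order: "p x < p x'" "p x' < p (\<phi> x)" "q x' < q x"
    and min: "x \<in> min_starts" "x' \<in> min_starts"
    using x' unfolding right_neighbour_def by auto
  obtain e where e: "e \<in> min_starts" "e \<noteq> x'" "p e < p (\<phi> x')" "q e < q (\<phi> x')"
    using ex_other_min_start[OF min(2)] by blast
  have "\<not> right_neighbour x' e" using rightmost order(1) by force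
  then have e_left: "p e < p x'" "q x' < q e"
    using min_starts_antichain[OF e(1) min(2) e(2)] e min unfolding right_neighbour_def by auto
  have "\<not> p x < p e"
  proof
    assume right: "p x < p e"
    then have "p (\<phi> x) < p (\<phi> e)"
      using X.less_iff e(1) min(1) min_starts_subset startsD(1) by blast
    then have "right_neighbour e x'" using e min e_left order unfolding right_neighbour_def by auto
    then show False using rightmost right by force
  qed
  then have "q x \<le> q e" using min_starts_antichain[OF e(1) min(1)] by force
  then show ?thesis using x' e unfolding crossing_def by auto
qed

lemma ex_crossing:
  assumes "starts \<noteq> {}"
  shows "\<exists>x x'. crossing x x'"
proof -
  define T where "T = {x. \<exists>m. right_neighbour x m}"
  have "T \<subseteq> starts" using min_starts_subset unfolding T_def right_neighbour_def by blast
  then have "finite T" using finite_starts by (rule finite_subset)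
  moreover have "T \<noteq> {}" using ex_right_neighbour[OF assms] unfolding T_def by blast
  ultimately obtain x where x: "x \<in> T" "\<And>w. w \<in> T \<Longrightarrow> p w \<le> p x"
    using ex_minimizer[of T "\<lambda>x. - p x"] by auto
  then obtain x' where "right_neighbour x x'" unfolding T_def by blast
  then have "crossing x x'"
    by (rule rightmost_right_neighbour_crossing) (use x(2) in \<open>auto simp: T_def\<close>)
  then show ?thesis by blast
qed

lemma crossingD:
  assumes "crossing x x'"
  shows "x \<in> min_starts" "x' \<in> min_starts" "p x < p x'" "p x' < p (\<phi> x)"
    "q x' < q x" "q x < q (\<phi> x')"
  using assms unfolding crossing_def right_neighbour_def by auto

lemma crossing_box_empty:
  assumes "crossing x x'" "z \<in> V"
  shows "\<not> (p x < p z \<and> p z < p x' \<and> q x' < q z \<and> q z < q x)"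
proof
  have "x \<in> starts" "x' \<in> starts" using crossingD(1,2)[OF assms(1)] min_starts_subset by auto
  note x = startsD[OF this(1)] and x' = startsD[OF this(2)]
  assume box: "p x < p z \<and> p z < p x' \<and> q x' < q z \<and> q z < q x"
  show False
  proof (rule box_of_close_points_empty[OF x(2) x'(2) _ \<open>z \<in> V\<close>])
    show "\<bar>p x - p x'\<bar> + \<bar>q x - q x'\<bar> \<le> 2 * num_deleted"
      using X.displacement_le_card_compl[OF x(1,4)] Y.displacement_le_card_compl[OF x'(1,5)]
        crossingD(3-6)[OF assms(1)] by linarith
  qed (use box in auto)
qed

lemma crossing_blockers_subset:
  assumes "crossing x x'"
  shows "X.blockers x \<inter> Y.blockers x' \<subseteq>
    {x, x'} \<union> {z \<in> V. p x' < p z \<and> p z < p (\<phi> x)} \<union> {z \<in> V. q x < q z \<and> q z < q (\<phi> x')}"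
proof
  fix z assume z: "z \<in> X.blockers x \<inter> Y.blockers x'"
  then have below: "z \<in> V" "p z < p (\<phi> x)" "q z < q (\<phi> x')"
    unfolding X.blockers_def Y.blockers_def by auto
  have V: "x \<in> V" "x' \<in> V"
    using crossingD(1,2)[OF assms] startsD(2) min_starts_subset by blast+
  have "z = x \<or> z = x' \<or> p x' < p z \<or> q x < q z"
  proof (rule ccontr)
    assume "\<not> ?thesis"
    then have bounds: "z \<noteq> x" "z \<noteq> x'" "p z < p x'" "q z < q x"
      using X.coord_eq_iff[OF below(1) V(2)] Y.coord_eq_iff[OF below(1) V(1)] by auto
    have "p x < p z \<and> q x' < q z"
    proof (cases "z \<in> A")
      case True
      then have "z \<in> starts" using z common_blocker_in_A_imp_start by blast
      then show ?thesis using crossingD(1,2)[OF assms] bounds unfolding min_starts_def by force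
    next
      case False
      then show ?thesis using z unfolding X.blockers_def Y.blockers_def by auto
    qed
    then show False using crossing_box_empty[OF assms below(1)] bounds by blast
  qed
  then show "z \<in> {x, x'} \<union> {z \<in> V. p x' < p z \<and> p z < p (\<phi> x)} \<union>
      {z \<in> V. q x < q z \<and> q z < q (\<phi> x')}"
    using below by auto
qed

lemma not_crossing: "\<not> crossing x x'"
proof
  assume crossing: "crossing x x'"
  note order = crossingD(3-6)[OF this]
  have "x \<in> starts" "x' \<in> starts" using crossingD(1,2)[OF crossing] min_starts_subset by auto
  note x = startsD[OF \<open>x \<in> starts\<close>] and x' = startsD[OF \<open>x' \<in> starts\<close>]
  define R where "R = {z \<in> V. p x' < p z \<and> p z < p (\<phi> x)}"
  define U where "U = {z \<in> V. q x < q z \<and> q z < q (\<phi> x')}"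
  have "card (X.blockers x \<inter> Y.blockers x') \<le> card ({x, x'} \<union> R \<union> U)"
    using crossing_blockers_subset[OF crossing] X.finite_V
    unfolding R_def U_def by (intro card_mono) auto
  also have "\<dots> \<le> card {x, x'} + card R + card U"
    using card_Un_le[of "{x, x'} \<union> R" U] card_Un_le[of "{x, x'}" R] by linarith
  also have "card {x, x'} \<le> 2" by (simp add: card_insert_if)
  finally have "int (card (X.blockers x \<inter> Y.blockers x')) \<le> 2 + int (card R) + int (card U)"
    by linarith
  moreover have "int (card R) \<le> p (\<phi> x) - p x' - 1"
    unfolding R_def by (rule X.card_coord_between[OF order(2)])
  moreover have "int (card U) \<le> q (\<phi> x') - q x - 1"
    unfolding U_def by (rule Y.card_coord_between[OF order(4)])
  ultimately have "p x' - p x + (q x - q x') \<le> num_deleted"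
    using displacement_sum_le[OF x(1,4) x'(1,5)] by linarith
  moreover have "x \<noteq> x'" using order by auto
  ultimately show False using dist_ge[OF x(2) x'(2)] order by linarith
qed

lemma starts_empty: "starts = {}"
  using ex_crossing not_crossing by blast

lemma no_increasing_shift:
  assumes "x \<in> A"
  shows "\<not> (p x < p (\<phi> x) \<and> q x < q (\<phi> x))"
proof
  define Q where "Q = {x \<in> A. p x < p (\<phi> x) \<and> q x < q (\<phi> x)}"
  assume "p x < p (\<phi> x) \<and> q x < q (\<phi> x)"
  then have "Q \<noteq> {}" using assms unfolding Q_def by auto
  moreover have "finite Q" using finite_subset[OF X.A_subset X.finite_V] unfolding Q_def by auto
  ultimately obtain m where m: "m \<in> Q" "\<And>w. w \<in> Q \<Longrightarrow> p m \<le> p w"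
    using ex_minimizer[of Q p] by blast
  have "m \<in> B" using m(1) starts_empty unfolding Q_def starts_def by blast
  then obtain u where u: "u \<in> A" "m = \<phi> u" using X.bij_phi by (auto simp: bij_betw_def)
  then have "u \<in> Q" "p u < p m"
    using X.less_iff[of u m] Y.less_iff[of u m] m(1) unfolding Q_def by auto
  then show False using m(2) by force
qed

lemma shift_trivial:
  assumes "x \<in> A"
  shows "\<phi> x = x"
proof (rule ccontr)
  assume "\<phi> x \<noteq> x"
  moreover have "x \<in> V" "\<phi> x \<in> V" using assms X.A_subset X.B_subset X.phi_in_B by auto
  ultimately have "p (\<phi> x) \<noteq> p x" "q (\<phi> x) \<noteq> q x"
    using X.coord_eq_iff Y.coord_eq_iff by blast+
  then consider "p x < p (\<phi> x)" "q x < q (\<phi> x)" | "p x > p (\<phi> x)" "q x < q (\<phi> x)"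
    | "p x < p (\<phi> x)" "q x > q (\<phi> x)" | "p x > p (\<phi> x)" "q x > q (\<phi> x)" by linarith
  then show False
    using no_increasing_shift[OF assms] spread_shift.no_increasing_shift[OF reflect_first assms]
      spread_shift.no_increasing_shift[OF reflect_second assms]
      spread_shift.no_increasing_shift[OF spread_shift.reflect_second[OF reflect_first] assms]
    by cases auto
qed

end

section \<open>Patterns\<close>

definition pattern_iso ::
    "('a::linorder \<Rightarrow> 'c::linorder) \<Rightarrow> 'a set \<Rightarrow> ('b::linorder \<Rightarrow> 'd::linorder) \<Rightarrow> 'b set \<Rightarrow>
      ('a \<Rightarrow> 'b) \<Rightarrow> bool"
  where "pattern_iso \<pi> A \<sigma> B \<phi> \<longleftrightarrow> bij_betw \<phi> A B \<and>
    (\<forall>u\<in>A. \<forall>v\<in>A. (\<phi> u < \<phi> v \<longleftrightarrow> u < v) \<and> (\<sigma> (\<phi> u) < \<sigma> (\<phi> v) \<longleftrightarrow> \<pi> u < \<pi> v))"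

definition same_pattern ::
    "('a::linorder \<Rightarrow> 'c::linorder) \<Rightarrow> 'a set \<Rightarrow> ('b::linorder \<Rightarrow> 'd::linorder) \<Rightarrow> 'b set \<Rightarrow> bool"
  where "same_pattern \<pi> A \<sigma> B \<longleftrightarrow> (\<exists>\<phi>. pattern_iso \<pi> A \<sigma> B \<phi>)"

lemma same_pattern_card_eq: "same_pattern \<pi> A \<sigma> B \<Longrightarrow> card A = card B"
  unfolding same_pattern_def pattern_iso_def by (blast intro: bij_betw_same_card)

lemma same_pattern_sym:
  assumes "same_pattern \<pi> A \<sigma> B"
  shows "same_pattern \<sigma> B \<pi> A"
proof -
  obtain \<phi> where iso: "pattern_iso \<pi> A \<sigma> B \<phi>" using assms unfolding same_pattern_def by blast
  then have bij: "bij_betw \<phi> A B" unfolding pattern_iso_def by blast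
  have inverse: "inv_into A \<phi> z \<in> A" "\<phi> (inv_into A \<phi> z) = z" if "z \<in> B" for z
    using bij that by (auto simp: bij_betw_def inv_into_into f_inv_into_f)
  have "pattern_iso \<sigma> B \<pi> A (inv_into A \<phi>)"
    unfolding pattern_iso_def
  proof (intro conjI ballI)
    fix u v assume "u \<in> B" "v \<in> B"
    then show "inv_into A \<phi> u < inv_into A \<phi> v \<longleftrightarrow> u < v"
      and "\<pi> (inv_into A \<phi> u) < \<pi> (inv_into A \<phi> v) \<longleftrightarrow> \<sigma> u < \<sigma> v"
      using iso inverse unfolding pattern_iso_def by metis+
  qed (rule bij_betw_inv_into[OF bij])
  then show ?thesis unfolding same_pattern_def by blast
qed

lemma same_pattern_trans:
  assumes "same_pattern \<pi> A \<sigma> B" "same_pattern \<sigma> B \<tau> C"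
  shows "same_pattern \<pi> A \<tau> C"
proof -
  obtain \<phi> \<psi> where "pattern_iso \<pi> A \<sigma> B \<phi>" "pattern_iso \<sigma> B \<tau> C \<psi>"
    using assms unfolding same_pattern_def by blast
  then have "pattern_iso \<pi> A \<tau> C (\<psi> \<circ> \<phi>)"
    unfolding pattern_iso_def by (auto intro: bij_betw_trans dest: bij_betwE)
  then show ?thesis unfolding same_pattern_def by blast
qed

lemma strict_mono_on_finite_endo_fixes:
  fixes h :: "'a::linorder \<Rightarrow> 'a"
  assumes "finite A" and mono: "strict_mono_on A h" and image: "h ` A = A" and a: "a \<in> A"
  shows "h a = a"
proof -
  have "bij_betw h {z \<in> A. z < a} {z \<in> A. z < h a}"
    unfolding bij_betw_def
  proof
    show "inj_on h {z \<in> A. z < a}"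
      using strict_mono_on_imp_inj_on[OF mono] by (rule inj_on_subset) auto
    have "h ` {z \<in> A. z < a} = {z \<in> h ` A. z < h a}"
      using strict_mono_on_less[OF mono _ a] by auto
    then show "h ` {z \<in> A. z < a} = {z \<in> A. z < h a}" using image by simp
  qed
  then have card_eq: "card {z \<in> A. z < a} = card {z \<in> A. z < h a}" by (rule bij_betw_same_card)
  have card_less: "card {z \<in> A. z < u} < card {z \<in> A. z < v}" if "u \<in> A" "u < v" for u v
    using \<open>finite A\<close> that by (intro psubset_card_mono) auto
  have "h a \<in> A" using image a by blast
  then show ?thesis
    using card_eq card_less[of a "h a"] card_less[of "h a" a] a
    by (cases a "h a" rule: linorder_cases) auto
qed

lemma same_pattern_Sym_unique:
  assumes \<pi>: "\<pi> \<in> Sym r" and \<rho>: "\<rho> \<in> Sym r" and "same_pattern \<pi> {1..r} \<rho> {1..r}"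
  shows "\<pi> = \<rho>"
proof
  fix a
  obtain \<phi> where \<phi>: "pattern_iso \<pi> {1..r} \<rho> {1..r} \<phi>"
    using assms(3) unfolding same_pattern_def by blast
  have perm: "\<pi> permutes {1..r}" "\<rho> permutes {1..r}" using \<pi> \<rho> unfolding Sym_def by auto
  have "\<phi> u = u" if "u \<in> {1..r}" for u
    using \<phi> by (intro strict_mono_on_finite_endo_fixes[OF _ _ _ that])
      (auto simp: pattern_iso_def bij_betw_def intro!: strict_mono_onI)
  then have less_iff: "\<rho> u < \<rho> v \<longleftrightarrow> \<pi> u < \<pi> v" if "u \<in> {1..r}" "v \<in> {1..r}" for u v
    using \<phi> that unfolding pattern_iso_def by metis
  show "\<pi> a = \<rho> a"
  proof (cases "a \<in> {1..r}")
    case True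
    have "strict_mono_on {1..r} (\<rho> \<circ> inv \<pi>)"
      using less_iff permutes_in_image[OF permutes_inv[OF perm(1)]] permutes_inverses(1)[OF perm(1)]
      by (intro strict_mono_onI) simp
    moreover have "(\<rho> \<circ> inv \<pi>) ` {1..r} = {1..r}"
      by (intro permutes_image permutes_compose permutes_inv perm)
    moreover have "\<pi> a \<in> {1..r}" using permutes_in_image[OF perm(1)] True by blast
    ultimately have "(\<rho> \<circ> inv \<pi>) (\<pi> a) = \<pi> a"
      by (rule strict_mono_on_finite_endo_fixes[OF finite_atLeastAtMost])
    then show ?thesis by (simp add: permutes_inverses(2)[OF perm(1)])
  next
    case False
    then show ?thesis using perm by (simp add: permutes_not_in)
  qed
qed

lemma ex_strict_mono_bij_betw_interval:
  fixes A :: "'a::wellorder set"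
  assumes "finite A"
  shows "\<exists>f. bij_betw f {1..card A} A \<and> strict_mono_on {1..card A} f"
proof -
  obtain h where h: "bij_betw h {..<card A} A" "strict_mono_on {..<card A} h"
    using ex_bij_betw_strict_mono_card[OF assms] .
  have "bij_betw (\<lambda>i. i - 1) {1..card A} {..<card A}"
    by (rule bij_betw_byWitness[where f' = Suc]) auto
  then have "bij_betw (h \<circ> (\<lambda>i. i - 1)) {1..card A} A" using h(1) by (rule bij_betw_trans)
  moreover have "strict_mono_on {1..card A} (h \<circ> (\<lambda>i. i - 1))"
    by (intro strict_mono_onI) (auto intro!: strict_mono_onD[OF h(2)])
  ultimately show ?thesis by blast
qed

lemma ex_Sym_same_pattern:
  fixes \<sigma> :: "'a::wellorder \<Rightarrow> 'b::wellorder"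
  assumes "finite A" and inj: "inj_on \<sigma> A"
  shows "\<exists>\<pi>\<in>Sym (card A). same_pattern \<pi> {1..card A} \<sigma> A"
proof -
  let ?I = "{1..card A}"
  obtain f where f: "bij_betw f ?I A" "strict_mono_on ?I f"
    using ex_strict_mono_bij_betw_interval[OF \<open>finite A\<close>] by blast
  obtain g where g: "bij_betw g ?I (\<sigma> ` A)" "strict_mono_on ?I g"
    using ex_strict_mono_bij_betw_interval[of "\<sigma> ` A"] \<open>finite A\<close> card_image[OF inj] by auto
  define \<pi> where "\<pi> a = (if a \<in> ?I then inv_into ?I g (\<sigma> (f a)) else a)" for a
  have "bij_betw (inv_into ?I g \<circ> \<sigma> \<circ> f) ?I ?I"
    using f(1) inj_on_imp_bij_betw[OF inj] bij_betw_inv_into[OF g(1)]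
    by (blast intro: bij_betw_trans)
  then have bij: "bij_betw \<pi> ?I ?I"
    by (subst bij_betw_cong[where g = "inv_into ?I g \<circ> \<sigma> \<circ> f"]) (simp_all add: \<pi>_def)
  then have "\<pi> permutes ?I" by (rule bij_imp_permutes) (simp only: \<pi>_def if_False)
  moreover have "pattern_iso \<pi> ?I \<sigma> A f"
    unfolding pattern_iso_def
  proof (intro conjI ballI)
    fix a b assume ab: "a \<in> ?I" "b \<in> ?I"
    then show "f a < f b \<longleftrightarrow> a < b" by (rule strict_mono_on_less[OF f(2)])
    have "\<pi> c \<in> ?I \<and> g (\<pi> c) = \<sigma> (f c)" if "c \<in> ?I" for c
      using that bij_betwE[OF bij] bij_betwE[OF f(1)] bij_betw_inv_into_right[OF g(1)]
      by (auto simp: \<pi>_def)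
    then show "\<sigma> (f a) < \<sigma> (f b) \<longleftrightarrow> \<pi> a < \<pi> b" using strict_mono_on_less[OF g(2)] ab by metis
  qed (rule f(1))
  ultimately show ?thesis unfolding Sym_def same_pattern_def by blast
qed

lemma contained_in_iff_same_pattern:
  "contained_in r \<pi> n \<sigma> \<longleftrightarrow> (\<exists>A\<subseteq>{1..n}. same_pattern \<pi> {1..r} \<sigma> A)"
proof
  assume "contained_in r \<pi> n \<sigma>"
  then obtain f where f: "f ` {1..r} \<subseteq> {1..n}" "strict_mono_on {1..r} f"
      "\<forall>a\<in>{1..r}. \<forall>b\<in>{1..r}. \<sigma> (f a) < \<sigma> (f b) \<longleftrightarrow> \<pi> a < \<pi> b"
    unfolding contained_in_def by blast
  then have "pattern_iso \<pi> {1..r} \<sigma> (f ` {1..r}) f"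
    using strict_mono_on_imp_inj_on[OF f(2)] strict_mono_on_less[OF f(2)]
    unfolding pattern_iso_def bij_betw_def by blast
  then show "\<exists>A\<subseteq>{1..n}. same_pattern \<pi> {1..r} \<sigma> A" using f(1) unfolding same_pattern_def by blast
next
  assume "\<exists>A\<subseteq>{1..n}. same_pattern \<pi> {1..r} \<sigma> A"
  then obtain f where "f ` {1..r} \<subseteq> {1..n}" "pattern_iso \<pi> {1..r} \<sigma> (f ` {1..r}) f"
    unfolding same_pattern_def pattern_iso_def bij_betw_def by blast
  then show "contained_in r \<pi> n \<sigma>"
    unfolding contained_in_def pattern_iso_def by (blast intro: strict_mono_onI)
qed

lemma prolific_iff:
  assumes "k \<le> n" and \<sigma>: "\<sigma> \<in> Sym n"
  shows "prolific k n \<sigma> \<longleftrightarrow>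
    (\<forall>A\<subseteq>{1..n}. \<forall>B\<subseteq>{1..n}. card A = n - k \<longrightarrow> card B = n - k \<longrightarrow> same_pattern \<sigma> A \<sigma> B \<longrightarrow> A = B)"
proof -
  define r where "r = n - k"
  define S where "S = {A. A \<subseteq> {1..n} \<and> card A = r}"
  have "\<exists>\<pi>\<in>Sym r. same_pattern \<pi> {1..r} \<sigma> A" if "A \<in> S" for A
    using that ex_Sym_same_pattern[of A \<sigma>] finite_subset[of A "{1..n}"] \<sigma> permutes_inj_on[of \<sigma>]
    unfolding S_def Sym_def by blast
  then obtain pat where pat: "pat A \<in> Sym r" "same_pattern (pat A) {1..r} \<sigma> A" if "A \<in> S" for A
    by metis
  have pat_unique: "pat A = \<pi>" if "A \<in> S" "\<pi> \<in> Sym r" "same_pattern \<pi> {1..r} \<sigma> A" for A \<pi>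
    using pat that by (blast intro: same_pattern_Sym_unique same_pattern_trans same_pattern_sym)
  have pat_eq_iff: "pat A = pat B \<longleftrightarrow> same_pattern \<sigma> A \<sigma> B" if "A \<in> S" "B \<in> S" for A B
    using pat pat_unique that by (metis same_pattern_sym same_pattern_trans)
  have "A \<in> S" if "A \<subseteq> {1..n}" "same_pattern \<pi> {1..r} \<sigma> A" for A \<pi>
    using that same_pattern_card_eq[OF that(2)] unfolding S_def by simp
  then have "{\<pi> \<in> Sym r. contained_in r \<pi> n \<sigma>} = pat ` S"
    using pat pat_unique unfolding contained_in_iff_same_pattern S_def by blast
  moreover have "card S = n choose k"
    using n_subsets[of "{1..n}" r] binomial_symmetric[OF \<open>k \<le> n\<close>] unfolding S_def r_def by simp
  ultimately have "prolific k n \<sigma> \<longleftrightarrow> card (pat ` S) = card S"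
    unfolding prolific_def r_def[symmetric] by simp
  also have "\<dots> \<longleftrightarrow> inj_on pat S" by (simp add: S_def inj_on_iff_eq_card)
  also have "\<dots> \<longleftrightarrow> (\<forall>A\<in>S. \<forall>B\<in>S. same_pattern \<sigma> A \<sigma> B \<longrightarrow> A = B)"
    using pat_eq_iff unfolding inj_on_def by blast
  finally show ?thesis unfolding S_def r_def by blast
qed

section \<open>Breadth\<close>

lemma breadth_ge_iff:
  assumes "n > 1"
  shows "d \<le> breadth n \<sigma> \<longleftrightarrow> (\<forall>i\<in>{1..n}. \<forall>j\<in>{1..n}. i \<noteq> j \<longrightarrow> d \<le> entry_dist \<sigma> i j)"
proof -
  define D where "D = {entry_dist \<sigma> i j | i j. i \<in> {1..n} \<and> j \<in> {1..n} \<and> i \<noteq> j}"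
  have "D \<subseteq> (\<lambda>(i, j). entry_dist \<sigma> i j) ` ({1..n} \<times> {1..n})" unfolding D_def by auto
  then have "finite D" using finite_subset by blast
  moreover have "entry_dist \<sigma> 1 n \<in> D" using assms unfolding D_def by force
  ultimately have "d \<le> breadth n \<sigma> \<longleftrightarrow> (\<forall>e\<in>D. d \<le> e)"
    unfolding breadth_def D_def[symmetric] by (subst Min_ge_iff) auto
  then show ?thesis unfolding D_def by blast
qed

definition separators :: "(nat \<Rightarrow> nat) \<Rightarrow> nat \<Rightarrow> nat \<Rightarrow> nat set" where
  "separators \<sigma> i j =
     {min i j<..<max i j} \<union> \<sigma> -` {min (\<sigma> i) (\<sigma> j)<..<max (\<sigma> i) (\<sigma> j)}"

lemma card_separators:
  assumes "inj \<sigma>" "i \<noteq> j"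
  shows "int (card (separators \<sigma> i j)) \<le> entry_dist \<sigma> i j - 2"
proof -
  have between: "int (card {min a b<..<max a b}) = \<bar>int a - int b\<bar> - 1" if "a \<noteq> b" for a b :: nat
    using that by (auto simp: min_def max_def)
  have "card (separators \<sigma> i j) \<le>
      card {min i j<..<max i j} + card (\<sigma> -` {min (\<sigma> i) (\<sigma> j)<..<max (\<sigma> i) (\<sigma> j)})"
    unfolding separators_def by (rule card_Un_le)
  also have "\<dots> \<le> card {min i j<..<max i j} + card {min (\<sigma> i) (\<sigma> j)<..<max (\<sigma> i) (\<sigma> j)}"
    using card_vimage_inj_on_le[OF assms(1), of "{min (\<sigma> i) (\<sigma> j)<..<max (\<sigma> i) (\<sigma> j)}"] by simp
  finally have "int (card (separators \<sigma> i j)) \<le>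
      int (card {min i j<..<max i j}) + int (card {min (\<sigma> i) (\<sigma> j)<..<max (\<sigma> i) (\<sigma> j)})"
    by linarith
  moreover have "\<sigma> i \<noteq> \<sigma> j" using injD[OF assms(1)] \<open>i \<noteq> j\<close> by blast
  ultimately show ?thesis
    using between[OF \<open>i \<noteq> j\<close>] between[of "\<sigma> i" "\<sigma> j"] unfolding entry_dist_def by linarith
qed

lemma separators_subset:
  assumes "\<sigma> permutes {1..n}" "i \<in> {1..n}" "j \<in> {1..n}"
  shows "separators \<sigma> i j \<subseteq> {1..n} - {i, j}"
proof
  fix z assume z: "z \<in> separators \<sigma> i j"
  have "\<sigma> i \<in> {1..n}" "\<sigma> j \<in> {1..n}" using assms by (simp_all only: permutes_in_image)
  then have "z \<in> {1..n} \<or> \<sigma> z \<in> {1..n}" using z assms(2,3) unfolding separators_def by auto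
  then have "z \<in> {1..n}" using permutes_in_image[OF assms(1)] by blast
  moreover have "z \<noteq> i" "z \<noteq> j" using z unfolding separators_def by auto
  ultimately show "z \<in> {1..n} - {i, j}" by simp
qed

lemma same_pattern_replace:
  assumes inj: "inj \<sigma>" and K: "i \<notin> K" "j \<notin> K" "K \<inter> separators \<sigma> i j = {}"
  shows "same_pattern \<sigma> (insert i K) \<sigma> (insert j K)"
proof -
  have same_side: "(z < i \<longleftrightarrow> z < j) \<and> (i < z \<longleftrightarrow> j < z) \<and>
      (\<sigma> z < \<sigma> i \<longleftrightarrow> \<sigma> z < \<sigma> j) \<and> (\<sigma> i < \<sigma> z \<longleftrightarrow> \<sigma> j < \<sigma> z)" if "z \<in> K" for z
  proof -
    have "z \<noteq> i" "z \<noteq> j" using that K by auto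
    moreover from this have "\<sigma> z \<noteq> \<sigma> i" "\<sigma> z \<noteq> \<sigma> j" using injD[OF inj] by blast+
    moreover have "z \<notin> separators \<sigma> i j" using that K by blast
    ultimately show ?thesis
      unfolding separators_def by (auto simp: min_def max_def split: if_splits)
  qed
  have "bij_betw (id(i := j)) (insert i K) (insert j K)"
    using K by (auto simp: bij_betw_def inj_on_def)
  then have "pattern_iso \<sigma> (insert i K) \<sigma> (insert j K) (id(i := j))"
    using same_side unfolding pattern_iso_def by auto
  then show ?thesis unfolding same_pattern_def by blast
qed

lemma close_imp_not_prolific:
  assumes k: "1 \<le> k" "k < n" and \<sigma>: "\<sigma> \<in> Sym n"
    and ij: "i \<in> {1..n}" "j \<in> {1..n}" "i \<noteq> j" and close: "entry_dist \<sigma> i j < int k + 2"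
  shows "\<not> prolific k n \<sigma>"
proof -
  have perm: "\<sigma> permutes {1..n}" using \<sigma> by (simp add: Sym_def)
  have inj: "inj \<sigma>" using perm by (rule permutes_inj)
  have card_others: "card ({1..n} - {i, j}) = n - 2" using ij by (simp add: card_Diff_subset)
  have "card (separators \<sigma> i j) \<le> k - 1" "k - 1 \<le> card ({1..n} - {i, j})"
    using card_separators[OF inj ij(3)] close card_others k by linarith+
  from exists_subset_between[OF this separators_subset[OF perm ij(1,2)]]
  obtain D where D: "separators \<sigma> i j \<subseteq> D" "D \<subseteq> {1..n} - {i, j}" "card D = k - 1"
    by blast
  define K where "K = {1..n} - {i, j} - D"
  have K: "i \<notin> K" "j \<notin> K" "K \<subseteq> {1..n}" "finite K" "K \<inter> separators \<sigma> i j = {}"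
    using D(1) unfolding K_def by auto
  have "card K = n - k - 1"
    using card_Diff_subset[of D "{1..n} - {i, j}"] D card_others k finite_subset[OF D(2)]
    unfolding K_def by auto
  then have cards: "card (insert i K) = n - k" "card (insert j K) = n - k" using K k by auto
  have same: "same_pattern \<sigma> (insert i K) \<sigma> (insert j K)"
    by (rule same_pattern_replace[OF inj K(1,2,5)])
  have "insert i K \<subseteq> {1..n}" "insert j K \<subseteq> {1..n}" using K ij by auto
  then have "insert i K = insert j K" if "prolific k n \<sigma>"
    using that cards same unfolding prolific_iff[OF less_imp_le[OF k(2)] \<sigma>] by blast
  moreover have "insert i K \<noteq> insert j K" using K ij by auto
  ultimately show ?thesis by blast
qed

lemma spread_same_pattern_imp_eq:
  assumes \<sigma>: "\<sigma> permutes {1..n}"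
    and spread: "\<And>i j. \<lbrakk>i \<in> {1..n}; j \<in> {1..n}; i \<noteq> j\<rbrakk> \<Longrightarrow> int (n - card B) + 2 \<le> entry_dist \<sigma> i j"
    and AB: "A \<subseteq> {1..n}" "B \<subseteq> {1..n}" "same_pattern \<sigma> A \<sigma> B"
  shows "A = B"
proof -
  obtain \<phi> where \<phi>: "pattern_iso \<sigma> A \<sigma> B \<phi>" using AB(3) unfolding same_pattern_def by blast
  then have bij: "bij_betw \<phi> A B" unfolding pattern_iso_def by blast
  have int_bij: "bij_betw int {1..n} {1..int n}"
    by (rule bij_betw_byWitness[where f' = nat]) auto
  have "bij_betw (int \<circ> \<sigma>) {1..n} {1..int n}"
    using permutes_imp_bij[OF \<sigma>] int_bij by (rule bij_betw_trans)
  moreover have "card ({1..n} - B) = n - card B"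
    using AB(2) finite_subset[OF AB(2)] by (simp add: card_Diff_subset)
  ultimately interpret spread_shift "{1..n}" A B \<phi> "int n" int "int \<circ> \<sigma>"
    using AB bij int_bij \<phi> spread
    by unfold_locales (auto simp: pattern_iso_def entry_dist_def)
  have "\<phi> ` A = A" using shift_trivial by simp
  then show ?thesis using bij unfolding bij_betw_def by simp
qed

theorem theorem2p25:
  fixes n k :: nat and \<sigma> :: "nat \<Rightarrow> nat"
  assumes "1 \<le> k" and "k < n" and "\<sigma> \<in> Sym n"
  shows "prolific k n \<sigma> \<longleftrightarrow> breadth n \<sigma> \<ge> int k + 2"
proof -
  have "n > 1" using assms by simp
  note breadth_iff = breadth_ge_iff[OF this]
  show ?thesis
  proof
    assume "prolific k n \<sigma>"
    then show "breadth n \<sigma> \<ge> int k + 2"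
      using close_imp_not_prolific[OF assms] unfolding breadth_iff by (meson not_le)
  next
    assume "breadth n \<sigma> \<ge> int k + 2"
    then have spread: "int k + 2 \<le> entry_dist \<sigma> i j"
      if "i \<in> {1..n}" "j \<in> {1..n}" "i \<noteq> j" for i j
      using that unfolding breadth_iff by blast
    have "\<sigma> permutes {1..n}" using assms(3) by (simp add: Sym_def)
    then have "A = B"
      if "A \<subseteq> {1..n}" "B \<subseteq> {1..n}" "card B = n - k" "same_pattern \<sigma> A \<sigma> B" for A B
      by (rule spread_same_pattern_imp_eq[OF _ _ that(1,2,4)])
        (use spread that(3) \<open>k < n\<close> in simp)
    then show "prolific k n \<sigma>"
      unfolding prolific_iff[OF less_imp_le[OF assms(2)] assms(3)] by blast
  qed
qed

end
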